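(* Let $A$ be a dendriform algebra. If $H^3_{\mathrm{dend}}(A,A)=0$, then every deformation of $A$ of finite order can be extended to a deformation of the next order; that is, for every $n\ge1$ and every deformation $\big(\sum_{i=0}^n\prec_i t^i,\ \sum_{i=0}^n\succ_i t^i\big)$ of order $n$ there exist bilinear maps $\prec_{n+1},\succ_{n+1}:A\otimes A\to A$ such that $\big(\sum_{i=0}^{n+1}\prec_i t^i,\ \sum_{i=0}^{n+1}\succ_i t^i\big)$ is a deformation of order $n+1$.
   Context: $\mathbb{K}$ is a field of characteristic $0$; all spaces and maps are over $\mathbb{K}$. Dendriform algebra: a vector space $A$ with bilinear $\prec,\succ$ satisfying $(a\prec b)\prec c=a\prec(b\prec c+b\succ c)$, $(a\succ b)\prec c=a\succ(b\prec c)$, $(a\prec b+a\succ b)\succ c=a\succ(b\succ c)$. $C_n=\{[1],\ldots,[n]\}$ is a set of $n$ symbols, $\mathbb{K}[C_n]$ the vector space with basis $C_n$. For $1\le i\le m$, $n\ge 1$: $R_0^{m,n,i}:C_{m+n-1}\to C_m$ sends $[r]$ to $[r]$ if $r\le i-1$, to $[i]$ if $i\le r\le i+n-1$, to $[r-n+1]$ if $r\ge i+n$; $R^{m,n,i}:C_{m+n-1}\to\mathbb{K}[C_n]$ sends $[r]$ to $[r-i+1]$ if $i\le r\le i+n-1$ and to $[1]+\cdots+[n]$ otherwise. Put $\pi_A([1];a,b)=a\prec b$, $\pi_A([2];a,b)=a\succ b$. Cochains: $C^n_{\mathrm{dend}}(A,A)=\mathrm{Hom}_{\mathbb{K}}(\mathbb{K}[C_n]\otimes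 A^{\otimes n},A)$, $n\ge1$, with $$(\delta_{\mathrm{dend}}f)([r];a_1,\ldots,a_{n+1})=\pi_A\big(R_0^{2,n,2}[r];a_1,f(R^{2,n,2}[r];a_2,\ldots,a_{n+1})\big)$$ $$+\sum_{i=1}^n(-1)^i f\big(R_0^{n,2,i}[r];a_1,\ldots,a_{i-1},\pi_A(R^{n,2,i}[r];a_i,a_{i+1}),a_{i+2},\ldots,a_{n+1}\big)$$ $$+(-1)^{n+1}\pi_A\big(R_0^{2,n,1}[r];f(R^{2,n,1}[r];a_1,\ldots,a_n),a_{n+1}\big).$$ $H^n_{\mathrm{dend}}(A,A)$ is the resulting cohomology, $n\ge2$. A deformation of order $n$ consists of bilinear maps $\prec_i,\succ_i:A\otimes A\to A$, $0\le i\le n$, with $\prec_0=\prec$, $\succ_0=\succ$, such that $\prec_t=\sum_{i=0}^n\prec_i t^i$ and $\succ_t=\sum_{i=0}^n\succ_i t^i$ satisfy the three dendriform identities modulo $t^{n+1}$, i.e. for all $0\le k\le n$ and $a,b,c\in A$: $\sum_{i+j=k}\big((a\prec_i b)\prec_j c-a\prec_i(b\prec_j c+b\succ_j c)\big)=0$, $\sum_{i+j=k}\big((a\succ_i b)\prec_j c-a\succ_i(b\prec_j c)\big)=0$, $\sum_{i+j=k}\big((a\prec_i b+a\succ_i b)\succ_j c-a\succ_i(b\succ_j c)\big)=0$. *)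

theory Defs
  imports Complex_Main
begin

definition bilinear_map ::
  "('k::field \<Rightarrow> 'a::ab_group_add \<Rightarrow> 'a) \<Rightarrow> ('a \<Rightarrow> 'a \<Rightarrow> 'a) \<Rightarrow> bool" where
  "bilinear_map scale B \<longleftrightarrow>
     (\<forall>a. Vector_Spaces.linear scale scale (\<lambda>b. B a b)) \<and>
     (\<forall>b. Vector_Spaces.linear scale scale (\<lambda>a. B a b))"

locale dendriform_algebra = vector_space scale
  for scale :: "'k::field \<Rightarrow> 'a::ab_group_add \<Rightarrow> 'a" +
  fixes prec succ :: "'a \<Rightarrow> 'a \<Rightarrow> 'a"
  assumes bilinear_prec: "bilinear_map scale prec"
    and bilinear_succ: "bilinear_map scale succ"
    and prec_prec: "prec (prec a b) c = prec a (prec b c + succ b c)"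
    and succ_prec: "prec (succ a b) c = succ a (prec b c)"
    and succ_succ: "succ (prec a b + succ a b) c = succ a (succ b c)"

text \<open>The symbol $[r]$ of $C_n$ is the natural number $r$ with $1 \le r \le n$.  An element of
  $K[C_n]$ is given by its coordinates in the basis $C_n$, a function from \<^typ>\<open>nat\<close> to the
  field that is zero outside $\{1, \ldots, n\}$.\<close>

definition basis_symbol :: "nat \<Rightarrow> nat \<Rightarrow> 'k::field" where
  "basis_symbol r = (\<lambda>s. if s = r then 1 else 0)"

definition R0 :: "nat \<Rightarrow> nat \<Rightarrow> nat \<Rightarrow> nat \<Rightarrow> nat" where
  "R0 m n i r = (if r \<le> i - 1 then r else if r \<le> i + n - 1 then i else r - n + 1)"

definition R :: "nat \<Rightarrow> nat \<Rightarrow> nat \<Rightarrow> nat \<Rightarrow> nat \<Rightarrow> 'k::field" where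
  "R m n i r =
     (if i \<le> r \<and> r \<le> i + n - 1 then basis_symbol (r - i + 1)
      else (\<lambda>s. \<Sum>q = 1..n. basis_symbol q s))"

text \<open>The value at $x \in K[C_n]$ of the linear map $K[C_n] \to A$ sending $[s]$ to $F(s)$.\<close>

definition lin_ext ::
  "('k::field \<Rightarrow> 'a::ab_group_add \<Rightarrow> 'a) \<Rightarrow> nat \<Rightarrow> (nat \<Rightarrow> 'a) \<Rightarrow> (nat \<Rightarrow> 'k) \<Rightarrow> 'a" where
  "lin_ext scale n F x = (\<Sum>s = 1..n. scale (x s) (F s))"

definition dend_pi ::
  "('a \<Rightarrow> 'a \<Rightarrow> 'a) \<Rightarrow> ('a \<Rightarrow> 'a \<Rightarrow> 'a) \<Rightarrow> nat \<Rightarrow> 'a \<Rightarrow> 'a \<Rightarrow> 'a" where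
  "dend_pi prec succ s a b = (if s = 1 then prec a b else succ a b)"

text \<open>A linear map $K[C_n] \otimes A^{\otimes n} \to A$ is encoded by its values
  $f([r]; a_1, \ldots, a_n)$ on basis symbols and pure tensors, the latter given as lists of
  length $n$.  The encoding is extended by zero to all other arguments, so that equality of
  cochains is equality of functions.\<close>

definition dend_cochains ::
  "('k::field \<Rightarrow> 'a::ab_group_add \<Rightarrow> 'a) \<Rightarrow> nat \<Rightarrow> (nat \<Rightarrow> 'a list \<Rightarrow> 'a) set" where
  "dend_cochains scale n =
     {f. (\<forall>r\<in>{1..n}. \<forall>as. length as = n \<longrightarrow>
            (\<forall>i<n. Vector_Spaces.linear scale scale (\<lambda>x. f r (as[i := x])))) \<and>
         (\<forall>r as. \<not> (r \<in> {1..n} \<and> length as = n) \<longrightarrow> f r as = 0)}"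

text \<open>List positions start at 0, so $a_i$ is \<open>as ! (i - 1)\<close>.\<close>

definition dend_delta ::
  "('k::field \<Rightarrow> 'a::ab_group_add \<Rightarrow> 'a) \<Rightarrow> ('a \<Rightarrow> 'a \<Rightarrow> 'a) \<Rightarrow> ('a \<Rightarrow> 'a \<Rightarrow> 'a) \<Rightarrow>
   nat \<Rightarrow> (nat \<Rightarrow> 'a list \<Rightarrow> 'a) \<Rightarrow> nat \<Rightarrow> 'a list \<Rightarrow> 'a" where
  "dend_delta scale prec succ n f r as =
     (if r \<in> {1..n+1} \<and> length as = n + 1 then
        dend_pi prec succ (R0 2 n 2 r) (as ! 0)
          (lin_ext scale n (\<lambda>s. f s (drop 1 as)) (R 2 n 2 r))
        + (\<Sum>i = 1..n. scale ((-1) ^ i)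
             (f (R0 n 2 i r)
               (take (i - 1) as
                @ [lin_ext scale 2 (\<lambda>s. dend_pi prec succ s (as ! (i - 1)) (as ! i)) (R n 2 i r)]
                @ drop (i + 1) as)))
        + scale ((-1) ^ (n + 1))
            (dend_pi prec succ (R0 2 n 1 r)
               (lin_ext scale n (\<lambda>s. f s (take n as)) (R 2 n 1 r)) (as ! n))
      else 0)"

definition dend_cocycles ::
  "('k::field \<Rightarrow> 'a::ab_group_add \<Rightarrow> 'a) \<Rightarrow> ('a \<Rightarrow> 'a \<Rightarrow> 'a) \<Rightarrow> ('a \<Rightarrow> 'a \<Rightarrow> 'a) \<Rightarrow>
   nat \<Rightarrow> (nat \<Rightarrow> 'a list \<Rightarrow> 'a) set" where
  "dend_cocycles scale prec succ n =
     {f \<in> dend_cochains scale n. dend_delta scale prec succ n f = (\<lambda>r as. 0)}"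

text \<open>The complex starts in degree 1, so coboundaries and cohomology are meant for $n \ge 2$.\<close>

definition dend_coboundaries ::
  "('k::field \<Rightarrow> 'a::ab_group_add \<Rightarrow> 'a) \<Rightarrow> ('a \<Rightarrow> 'a \<Rightarrow> 'a) \<Rightarrow> ('a \<Rightarrow> 'a \<Rightarrow> 'a) \<Rightarrow>
   nat \<Rightarrow> (nat \<Rightarrow> 'a list \<Rightarrow> 'a) set" where
  "dend_coboundaries scale prec succ n =
     dend_delta scale prec succ (n - 1) ` dend_cochains scale (n - 1)"

definition dend_cohomology ::
  "('k::field \<Rightarrow> 'a::ab_group_add \<Rightarrow> 'a) \<Rightarrow> ('a \<Rightarrow> 'a \<Rightarrow> 'a) \<Rightarrow> ('a \<Rightarrow> 'a \<Rightarrow> 'a) \<Rightarrow>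
   nat \<Rightarrow> (nat \<Rightarrow> 'a list \<Rightarrow> 'a) set set" where
  "dend_cohomology scale prec succ n =
     dend_cocycles scale prec succ n //
       {(f, g). f \<in> dend_cocycles scale prec succ n \<and> g \<in> dend_cocycles scale prec succ n \<and>
                (\<lambda>r as. f r as - g r as) \<in> dend_coboundaries scale prec succ n}"

text \<open>The zero element of the quotient is the coset formed by the coboundaries themselves.\<close>

definition dend_cohomology_vanishes ::
  "('k::field \<Rightarrow> 'a::ab_group_add \<Rightarrow> 'a) \<Rightarrow> ('a \<Rightarrow> 'a \<Rightarrow> 'a) \<Rightarrow> ('a \<Rightarrow> 'a \<Rightarrow> 'a) \<Rightarrow>
   nat \<Rightarrow> bool" where
  "dend_cohomology_vanishes scale prec succ n \<longleftrightarrow>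
     dend_cohomology scale prec succ n = {dend_coboundaries scale prec succ n}"

text \<open>\<open>P i\<close> and \<open>S i\<close> are the coefficients of $t^i$; only those with $i \le n$ matter.\<close>

definition dend_deformation ::
  "('k::field \<Rightarrow> 'a::ab_group_add \<Rightarrow> 'a) \<Rightarrow> ('a \<Rightarrow> 'a \<Rightarrow> 'a) \<Rightarrow> ('a \<Rightarrow> 'a \<Rightarrow> 'a) \<Rightarrow>
   nat \<Rightarrow> (nat \<Rightarrow> 'a \<Rightarrow> 'a \<Rightarrow> 'a) \<Rightarrow> (nat \<Rightarrow> 'a \<Rightarrow> 'a \<Rightarrow> 'a) \<Rightarrow> bool" where
  "dend_deformation scale prec succ n P S \<longleftrightarrow>
     (\<forall>i\<le>n. bilinear_map scale (P i) \<and> bilinear_map scale (S i)) \<and>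
     P 0 = prec \<and> S 0 = succ \<and>
     (\<forall>k\<le>n. \<forall>a b c.
        (\<Sum>(i, j)\<in>{(i, j). i + j = k}. P j (P i a b) c - P i a (P j b c + S j b c)) = 0 \<and>
        (\<Sum>(i, j)\<in>{(i, j). i + j = k}. P j (S i a b) c - S i a (P j b c)) = 0 \<and>
        (\<Sum>(i, j)\<in>{(i, j). i + j = k}. S j (P i a b + S i a b) c - S i a (S j b c)) = 0)"

end

theory Submission imports Defs "HOL-Library.Product_Plus" begin

text \<open>
  Let $D_m(a, b, c)$ be the coefficient of $t^m$ in the three dendriform identities for the maps
  $\prec_t, \succ_t$, so that a deformation of order $n$ is one with $D_0 = \cdots = D_n = 0$.
  Extend it by zero in degrees above $n$ and put $N = n + 1$.  Then $D_N$ is a 3-cochain, the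
  obstruction.  Adding maps $\prec_N, \succ_N$ in degree $N$ changes $D_N$ by
  $-\delta_{\mathrm{dend}}(\prec_N, \succ_N)$ (\<open>dend_defect_update\<close>), so an extension exists as soon
  as $D_N$ is a coboundary.  As $H^3_{\mathrm{dend}} = 0$, it suffices that $D_N$ is a cocycle.

  The cocycle property comes from an identity that needs no axiom on the product.  For every
  biadditive product the associator $\alpha(x, y, z) = (xy)z - x(yz)$ satisfies
  \[w\,\alpha(x,y,z) - \alpha(wx,y,z) + \alpha(w,xy,z) - \alpha(w,x,yz) + \alpha(w,x,y)\,z = 0,\]
  because the ten terms cancel in pairs.  For a power series of products this holds in each degree
  (\<open>assoc_defect_bianchi\<close>).  If the associator vanishes in all degrees below $N$, only the terms
  with the product of degree 0 survive in degree $N$, and they say that the degree $N$ part of the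
  associator is a Hochschild cocycle (\<open>assoc_defect_lowest_cocycle\<close>).

  To pass from associative to dendriform products, let $A'$ be a second copy of $A$ and multiply on
  $A \oplus A'$ by $a\,b = a \prec b + a \succ b$, $a'\,b = (a \prec b)'$, $a\,b' = (a \succ b)'$,
  $a'\,b' = 0$.  The associator of $(a, b, c)$ with the argument number $r$ taken from $A'$ is the
  $r$-th dendriform expression, and the associator with all arguments from $A$ is the sum of the
  three (\<open>assoc_defect_semidirect\<close>).  In the same way the Hochschild cocycle condition with the
  argument number $r \in \{1, \ldots, 4\}$ taken from $A'$ is the dendriform cocycle condition at
  the symbol $[r]$ (\<open>dend_defect_lowest_cocycle\<close>, \<open>dend_delta_3\<close>).
\<close>

section \<open>Associators of power series of biadditive products\<close>

definition biadditive :: "('a::ab_group_add \<Rightarrow> 'a \<Rightarrow> 'a) \<Rightarrow> bool" where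
  "biadditive M \<longleftrightarrow>
     (\<forall>x y z. M (x + y) z = M x z + M y z) \<and> (\<forall>x y z. M x (y + z) = M x y + M x z)"

lemma biadditive_add:
  assumes "biadditive M"
  shows "M (x + y) z = M x z + M y z" "M x (y + z) = M x y + M x z"
  using assms by (auto simp: biadditive_def)

lemma biadditive_zero:
  assumes "biadditive M"
  shows "M 0 z = 0" "M z 0 = 0"
  using biadditive_add[OF assms, of 0 0 z] biadditive_add[OF assms, of z 0 0] by auto

lemma biadditive_diff:
  assumes "biadditive M"
  shows "M (x - y) z = M x z - M y z" "M x (y - z) = M x y - M x z"
  using biadditive_add(1)[OF assms, of "x - y" y z] biadditive_add(2)[OF assms, of x "y - z" z]
  by (simp_all add: algebra_simps)

lemma biadditive_sum:
  assumes "biadditive M"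
  shows "M (sum f A) z = (\<Sum>i\<in>A. M (f i) z)" "M z (sum f A) = (\<Sum>i\<in>A. M z (f i))"
  using sum_comp_morphism[of "\<lambda>x. M x z" f A] sum_comp_morphism[of "M z" f A]
  by (simp_all add: biadditive_zero[OF assms] biadditive_add[OF assms] o_def)

text \<open>The coefficient of $t^m$ in the associator of the product $\sum_i M_i t^i$, for arguments that
  do not depend on $t$.\<close>

definition assoc_defect ::
  "(nat \<Rightarrow> 'a::ab_group_add \<Rightarrow> 'a \<Rightarrow> 'a) \<Rightarrow> nat \<Rightarrow> 'a \<Rightarrow> 'a \<Rightarrow> 'a \<Rightarrow> 'a" where
  "assoc_defect M m x y z =
     (\<Sum>(i, j)\<in>{(i, j). i + j = m}. M j (M i x y) z - M i x (M j y z))"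

lemma finite_pairs_sum_eq: "finite {(i, j). i + j = (m::nat)}"
  by (rule finite_subset[of _ "{..m} \<times> {..m}"]) auto

lemma sum_pairs_nested:
  "(\<Sum>(k, m)\<in>{(k, m). k + m = (N::nat)}. \<Sum>(i, j)\<in>{(i, j). i + j = m}. F k i j) =
   (\<Sum>(k, i, j)\<in>{(k, i, j). k + i + j = N}. (F k i j :: 'a::comm_monoid_add))"
proof -
  have "(\<Sum>(k, m)\<in>{(k, m). k + m = N}. \<Sum>(i, j)\<in>{(i, j). i + j = m}. F k i j) =
        (\<Sum>u\<in>{(k, m). k + m = N}. \<Sum>v\<in>{(i, j). i + j = snd u}. F (fst u) (fst v) (snd v))"
    by (simp add: case_prod_unfold)
  also have "\<dots> = (\<Sum>(u, v)\<in>Sigma {(k, m). k + m = N} (\<lambda>u. {(i, j). i + j = snd u}).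
                     F (fst u) (fst v) (snd v))"
    by (rule sum.Sigma) (auto simp: finite_pairs_sum_eq)
  also have "\<dots> = (\<Sum>(k, i, j)\<in>{(k, i, j). k + i + j = N}. F k i j)"
    by (rule sum.reindex_bij_witness[where i = "\<lambda>(k, i, j). ((k, i + j), (i, j))"
          and j = "\<lambda>(u, (i, j)). (fst u, i, j)"]) auto
  finally show ?thesis .
qed

lemma sum_triples_permute:
  fixes F :: "nat \<Rightarrow> nat \<Rightarrow> nat \<Rightarrow> 'a::comm_monoid_add" and N :: nat
  defines "T \<equiv> {(k, i, j). k + i + j = N}"
  shows "(\<Sum>(k, i, j)\<in>T. F i k j) = (\<Sum>(k, i, j)\<in>T. F k i j)"
    and "(\<Sum>(k, i, j)\<in>T. F j i k) = (\<Sum>(k, i, j)\<in>T. F k i j)"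
    and "(\<Sum>(k, i, j)\<in>T. F i j k) = (\<Sum>(k, i, j)\<in>T. F k i j)"
proof -
  show "(\<Sum>(k, i, j)\<in>T. F i k j) = (\<Sum>(k, i, j)\<in>T. F k i j)"
    by (rule sum.reindex_bij_witness[where i = "\<lambda>(k, i, j). (i, k, j)"
          and j = "\<lambda>(k, i, j). (i, k, j)"]) (auto simp: T_def)
  show "(\<Sum>(k, i, j)\<in>T. F j i k) = (\<Sum>(k, i, j)\<in>T. F k i j)"
    by (rule sum.reindex_bij_witness[where i = "\<lambda>(k, i, j). (j, i, k)"
          and j = "\<lambda>(k, i, j). (j, i, k)"]) (auto simp: T_def)
  show "(\<Sum>(k, i, j)\<in>T. F i j k) = (\<Sum>(k, i, j)\<in>T. F k i j)"
    by (rule sum.reindex_bij_witness[where i = "\<lambda>(k, i, j). (j, k, i)"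
          and j = "\<lambda>(k, i, j). (i, j, k)"]) (auto simp: T_def)
qed

text \<open>Every product of four factors occurs twice in the expanded sum, with opposite signs and with its
  degrees $(k, i, j)$ permuted.  The sum over all triples of total degree $N$ does not see the
  permutation.\<close>

lemma assoc_defect_bianchi:
  fixes M :: "nat \<Rightarrow> 'a::ab_group_add \<Rightarrow> 'a \<Rightarrow> 'a"
  assumes M: "\<And>i. biadditive (M i)"
  shows "(\<Sum>(k, m)\<in>{(k, m). k + m = N}.
            M k w (assoc_defect M m x y z) - assoc_defect M m (M k w x) y z
            + assoc_defect M m w (M k x y) z - assoc_defect M m w x (M k y z)
            + M k (assoc_defect M m w x y) z) = 0"
proof -
  let ?T = "{(k, i, j). k + i + j = N}"
  let ?S = "\<lambda>F. \<Sum>(k, i, j)\<in>?T. F k i j"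
  let ?E = "\<lambda>k i j. (M k w (M j (M i x y) z) - M k w (M i x (M j y z)))
     - (M j (M i (M k w x) y) z - M i (M k w x) (M j y z))
     + (M j (M i w (M k x y)) z - M i w (M j (M k x y) z))
     - (M j (M i w x) (M k y z) - M i w (M j x (M k y z)))
     + (M k (M j (M i w x) y) z - M k (M i w (M j x y)) z)"
  have "(\<Sum>(k, m)\<in>{(k, m). k + m = N}.
            M k w (assoc_defect M m x y z) - assoc_defect M m (M k w x) y z
            + assoc_defect M m w (M k x y) z - assoc_defect M m w x (M k y z)
            + M k (assoc_defect M m w x y) z) =
        (\<Sum>(k, m)\<in>{(k, m). k + m = N}. \<Sum>(i, j)\<in>{(i, j). i + j = m}. ?E k i j)"
    by (simp add: assoc_defect_def biadditive_sum[OF M] biadditive_diff[OF M] case_prod_unfold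
        sum.distrib sum_subtractf)
  also have "\<dots> = ?S ?E" by (rule sum_pairs_nested)
  also have "\<dots> =
      (?S (\<lambda>k i j. M k w (M j (M i x y) z)) - ?S (\<lambda>k i j. M k w (M i x (M j y z))))
     - (?S (\<lambda>k i j. M j (M i (M k w x) y) z) - ?S (\<lambda>k i j. M i (M k w x) (M j y z)))
     + (?S (\<lambda>k i j. M j (M i w (M k x y)) z) - ?S (\<lambda>k i j. M i w (M j (M k x y) z)))
     - (?S (\<lambda>k i j. M j (M i w x) (M k y z)) - ?S (\<lambda>k i j. M i w (M j x (M k y z))))
     + (?S (\<lambda>k i j. M k (M j (M i w x) y) z) - ?S (\<lambda>k i j. M k (M i w (M j x y)) z))"
    by (simp add: case_prod_unfold sum.distrib sum_subtractf)
  also have "\<dots> = 0"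
    using sum_triples_permute(1)[where F = "\<lambda>k i j. M k w (M j (M i x y) z)" and N = N]
      sum_triples_permute(3)[where F = "\<lambda>k i j. M k w (M i x (M j y z))" and N = N]
      sum_triples_permute(3)[where F = "\<lambda>k i j. M j (M i (M k w x) y) z" and N = N]
      sum_triples_permute(3)[where F = "\<lambda>k i j. M i (M k w x) (M j y z)" and N = N]
      sum_triples_permute(2)[where F = "\<lambda>k i j. M j (M i w (M k x y)) z" and N = N]
    by (simp add: algebra_simps)
  finally show ?thesis .
qed


text \<open>If the product is associative modulo $t^N$, the coefficient of $t^N$ in its associator is a
  Hochschild 3-cocycle for the product in degree 0.\<close>

lemma assoc_defect_lowest_cocycle:
  fixes M :: "nat \<Rightarrow> 'a::ab_group_add \<Rightarrow> 'a \<Rightarrow> 'a"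
  assumes M: "\<And>i. biadditive (M i)"
    and lower: "\<And>m x y z. m < N \<Longrightarrow> assoc_defect M m x y z = 0"
  shows "M 0 w (assoc_defect M N x y z) - assoc_defect M N (M 0 w x) y z
         + assoc_defect M N w (M 0 x y) z - assoc_defect M N w x (M 0 y z)
         + M 0 (assoc_defect M N w x y) z = 0" (is "?E 0 N = 0")
proof -
  have "0 = (\<Sum>(k, m)\<in>{(k, m). k + m = N}. ?E k m)"
    by (rule assoc_defect_bianchi[OF M, symmetric])
  also have "\<dots> = (\<Sum>(k, m)\<in>{(0, N)}. ?E k m)"
  proof (rule sum.mono_neutral_right)
    have "?E k m = 0" if "m < N" for k m
      by (simp add: lower[OF that] biadditive_zero[OF M])
    moreover have "snd u < N" if "u \<in> {(k, m). k + m = N} - {(0, N)}" for u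
      using that by (cases u) auto
    ultimately show "\<forall>u\<in>{(k, m). k + m = N} - {(0, N)}. (case u of (k, m) \<Rightarrow> ?E k m) = 0"
      by (simp add: case_prod_unfold)
  qed (auto simp: finite_pairs_sum_eq)
  finally show ?thesis by simp
qed

section \<open>Dendriform products as products on a semidirect sum\<close>

text \<open>The product on $A \oplus A'$, where $A'$ is a copy of $A$ on which $A$ acts from the right by
  \<open>p\<close> (for $\prec$) and from the left by \<open>s\<close> (for $\succ$); the product of two elements of $A'$ is
  zero.\<close>

definition semidirect ::
  "('a::ab_group_add \<Rightarrow> 'a \<Rightarrow> 'a) \<Rightarrow> ('a \<Rightarrow> 'a \<Rightarrow> 'a) \<Rightarrow> 'a \<times> 'a \<Rightarrow> 'a \<times> 'a \<Rightarrow> 'a \<times> 'a" where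
  "semidirect p s = (\<lambda>(a, a') (b, b'). (p a b + s a b, p a' b + s a b'))"

lemma semidirect_Pair [simp]:
  "semidirect p s (a, a') (b, b') = (p a b + s a b, p a' b + s a b')"
  by (simp add: semidirect_def)

lemma biadditive_semidirect:
  assumes "biadditive p" "biadditive s"
  shows "biadditive (semidirect p s)"
  unfolding biadditive_def
  by (auto simp: biadditive_add[OF assms(1)] biadditive_add[OF assms(2)] algebra_simps)

text \<open>The coefficient of $t^m$ in the identity number \<open>r\<close> of the three dendriform identities, left
  side minus right side, for $\prec_t = \sum_i P_i t^i$ and $\succ_t = \sum_i S_i t^i$.  The number of
  the identity is meant as the symbol $[r]$ of $C_3$; every \<open>r\<close> other than 1 and 2 gives the third.\<close>

definition dend_defect ::
  "(nat \<Rightarrow> 'a::ab_group_add \<Rightarrow> 'a \<Rightarrow> 'a) \<Rightarrow> (nat \<Rightarrow> 'a \<Rightarrow> 'a \<Rightarrow> 'a) \<Rightarrow>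
   nat \<Rightarrow> nat \<Rightarrow> 'a \<Rightarrow> 'a \<Rightarrow> 'a \<Rightarrow> 'a" where
  "dend_defect P S m r a b c =
     (\<Sum>(i, j)\<in>{(i, j). i + j = m}.
        if r = 1 then P j (P i a b) c - P i a (P j b c + S j b c)
        else if r = 2 then P j (S i a b) c - S i a (P j b c)
        else S j (P i a b + S i a b) c - S i a (S j b c))"

lemma dend_deformation_iff:
  "dend_deformation scale prec succ n P S \<longleftrightarrow>
     (\<forall>i\<le>n. bilinear_map scale (P i) \<and> bilinear_map scale (S i)) \<and> P 0 = prec \<and> S 0 = succ \<and>
     (\<forall>k\<le>n. \<forall>r\<in>{1, 2, 3}. \<forall>a b c. dend_defect P S k r a b c = 0)"
  unfolding dend_deformation_def dend_defect_def by auto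

lemma dend_defect_cong:
  assumes "\<And>i. i \<le> m \<Longrightarrow> P i = P' i" "\<And>i. i \<le> m \<Longrightarrow> S i = S' i"
  shows "dend_defect P S m r a b c = dend_defect P' S' m r a b c"
  unfolding dend_defect_def by (rule sum.cong) (auto simp: assms)

lemma assoc_defect_semidirect:
  assumes P: "\<And>i. biadditive (P i)" and S: "\<And>i. biadditive (S i)"
  shows "assoc_defect (\<lambda>i. semidirect (P i) (S i)) m (a, a') (b, b') (c, c') =
    (dend_defect P S m 1 a b c + dend_defect P S m 2 a b c + dend_defect P S m 3 a b c,
     dend_defect P S m 1 a' b c + dend_defect P S m 2 a b' c + dend_defect P S m 3 a b c')"
  unfolding assoc_defect_def dend_defect_def
  by (simp add: case_prod_unfold prod_eq_iff fst_sum snd_sum sum.distrib[symmetric]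
      biadditive_add[OF P] biadditive_add[OF S])
    (auto intro!: sum.cong simp: algebra_simps)

lemma dend_defect_zero:
  assumes P: "\<And>i. biadditive (P i)" and S: "\<And>i. biadditive (S i)"
  shows "dend_defect P S m r 0 b c = 0" "dend_defect P S m r a 0 c = 0"
    "dend_defect P S m r a b 0 = 0"
  unfolding dend_defect_def
  by (auto intro!: sum.neutral simp: biadditive_zero[OF P] biadditive_zero[OF S])

text \<open>The four identities are the cocycle condition at $[1], \ldots, [4]$, written out for \<open>D\<close>.\<close>

lemma dend_defect_lowest_cocycle:
  fixes P S :: "nat \<Rightarrow> 'a::ab_group_add \<Rightarrow> 'a \<Rightarrow> 'a"
  assumes P: "\<And>i. biadditive (P i)" and S: "\<And>i. biadditive (S i)"
    and lower: "\<And>m r a b c. m < N \<Longrightarrow> r \<in> {1, 2, 3} \<Longrightarrow> dend_defect P S m r a b c = 0"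
  defines "D \<equiv> dend_defect P S N"
  shows "P 0 w (D 1 x y z + D 2 x y z + D 3 x y z) - D 1 (P 0 w x) y z
           + D 1 w (P 0 x y + S 0 x y) z - D 1 w x (P 0 y z + S 0 y z) + P 0 (D 1 w x y) z = 0"
    and "S 0 w (D 1 x y z) - D 1 (S 0 w x) y z + D 2 w (P 0 x y) z
           - D 2 w x (P 0 y z + S 0 y z) + P 0 (D 2 w x y) z = 0"
    and "S 0 w (D 2 x y z) - D 2 (P 0 w x + S 0 w x) y z + D 2 w (S 0 x y) z
           - D 3 w x (P 0 y z) + P 0 (D 3 w x y) z = 0"
    and "S 0 w (D 3 x y z) - D 3 (P 0 w x + S 0 w x) y z + D 3 w (P 0 x y + S 0 x y) z
           - D 3 w x (S 0 y z) + S 0 (D 1 w x y + D 2 w x y + D 3 w x y) z = 0"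
proof -
  let ?M = "\<lambda>i. semidirect (P i) (S i)"
  have lowerM: "assoc_defect ?M m u v t = 0" if "m < N" for m u v t
    by (cases u; cases v; cases t)
      (simp add: assoc_defect_semidirect[OF P S] lower[OF that] zero_prod_def)
  note cocycle = assoc_defect_lowest_cocycle[of ?M N, OF biadditive_semidirect[OF P S] lowerM]
  note simps = assoc_defect_semidirect[OF P S] dend_defect_zero[of P S, OF P S, where m = N, folded D_def]
    biadditive_zero[OF P] biadditive_zero[OF S] D_def[symmetric] prod_eq_iff
  \<comment> \<open>The condition at \<open>[r]\<close> is the second component, with only the argument number \<open>r\<close> primed.\<close>
  show "P 0 w (D 1 x y z + D 2 x y z + D 3 x y z) - D 1 (P 0 w x) y z
           + D 1 w (P 0 x y + S 0 x y) z - D 1 w x (P 0 y z + S 0 y z) + P 0 (D 1 w x y) z = 0"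
    using cocycle[of "(0, w)" "(x, 0)" "(y, 0)" "(z, 0)"] by (simp add: simps)
  show "S 0 w (D 1 x y z) - D 1 (S 0 w x) y z + D 2 w (P 0 x y) z
           - D 2 w x (P 0 y z + S 0 y z) + P 0 (D 2 w x y) z = 0"
    using cocycle[of "(w, 0)" "(0, x)" "(y, 0)" "(z, 0)"] by (simp add: simps)
  show "S 0 w (D 2 x y z) - D 2 (P 0 w x + S 0 w x) y z + D 2 w (S 0 x y) z
           - D 3 w x (P 0 y z) + P 0 (D 3 w x y) z = 0"
    using cocycle[of "(w, 0)" "(x, 0)" "(0, y)" "(z, 0)"] by (simp add: simps)
  show "S 0 w (D 3 x y z) - D 3 (P 0 w x + S 0 w x) y z + D 3 w (P 0 x y + S 0 x y) z
           - D 3 w x (S 0 y z) + S 0 (D 1 w x y + D 2 w x y + D 3 w x y) z = 0"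
    using cocycle[of "(w, 0)" "(x, 0)" "(y, 0)" "(0, z)"] by (simp add: simps)
qed

section \<open>Changing the top coefficients\<close>

text \<open>Coefficients in degree \<open>N \<ge> 1\<close> enter the defect of degree \<open>N\<close> linearly, paired with those
  of degree 0.  The added terms are $-\delta_{\mathrm{dend}}(p, s)$; compare \<open>dend_delta_2\<close> below.\<close>

lemma dend_defect_update:
  fixes P S :: "nat \<Rightarrow> 'a::ab_group_add \<Rightarrow> 'a \<Rightarrow> 'a" and p s :: "'a \<Rightarrow> 'a \<Rightarrow> 'a"
  assumes "N \<ge> 1" and P: "biadditive (P 0)" and S: "biadditive (S 0)"
    and P_N: "P N = (\<lambda>_ _. 0)" and S_N: "S N = (\<lambda>_ _. 0)"
  defines "D \<equiv> dend_defect (P(N := p)) (S(N := s)) N" and "D\<^sub>0 \<equiv> dend_defect P S N"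
  shows "D 1 a b c = D\<^sub>0 1 a b c + (p (P 0 a b) c - P 0 a (p b c + s b c)
           + P 0 (p a b) c - p a (P 0 b c + S 0 b c))"
    and "D 2 a b c = D\<^sub>0 2 a b c + (p (S 0 a b) c - S 0 a (p b c)
           + P 0 (s a b) c - s a (P 0 b c))"
    and "D 3 a b c = D\<^sub>0 3 a b c + (s (P 0 a b + S 0 a b) c - S 0 a (s b c)
           + S 0 (p a b + s a b) c - s a (S 0 b c))"
proof -
  let ?K = "{(i, j). i + j = N \<and> i \<noteq> N \<and> j \<noteq> N}"
  \<comment> \<open>For \<open>N \<ge> 1\<close> the pairs \<open>(0, N)\<close> and \<open>(N, 0)\<close> are distinct, and only they involve degree \<open>N\<close>.\<close>
  have split: "(\<Sum>(i, j)\<in>{(i, j). i + j = N}. F i j) = (\<Sum>(i, j)\<in>?K. F i j) + (F 0 N + F N 0)"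
    for F :: "nat \<Rightarrow> nat \<Rightarrow> 'a"
  proof -
    have "{(i, j). i + j = N} = insert (0, N) (insert (N, 0) ?K)" by auto
    moreover have "finite ?K"
      by (rule finite_subset[OF _ finite_pairs_sum_eq[of N]]) auto
    ultimately show ?thesis using \<open>N \<ge> 1\<close> by (simp add: algebra_simps)
  qed
  have middle: "(\<Sum>(i, j)\<in>?K. F (P i) (S i) (P j) (S j)) =
      (\<Sum>(i, j)\<in>?K. F ((P(N := p)) i) ((S(N := s)) i) ((P(N := p)) j) ((S(N := s)) j))"
    for F :: "_ \<Rightarrow> _ \<Rightarrow> _ \<Rightarrow> _ \<Rightarrow> 'a"
    by (rule sum.cong) auto
  note simps = D_def D\<^sub>0_def dend_defect_def split P_N S_N
    biadditive_zero[OF P] biadditive_zero[OF S]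
  show "D 1 a b c = D\<^sub>0 1 a b c + (p (P 0 a b) c - P 0 a (p b c + s b c)
           + P 0 (p a b) c - p a (P 0 b c + S 0 b c))"
    using middle[of "\<lambda>pi si pj sj. pj (pi a b) c - pi a (pj b c + sj b c)"] \<open>N \<ge> 1\<close>
    by (simp add: simps del: fun_upd_apply) (simp add: algebra_simps)
  show "D 2 a b c = D\<^sub>0 2 a b c + (p (S 0 a b) c - S 0 a (p b c)
           + P 0 (s a b) c - s a (P 0 b c))"
    using middle[of "\<lambda>pi si pj sj. pj (si a b) c - si a (pj b c)"] \<open>N \<ge> 1\<close>
    by (simp add: simps del: fun_upd_apply) (simp add: algebra_simps)
  show "D 3 a b c = D\<^sub>0 3 a b c + (s (P 0 a b + S 0 a b) c - S 0 a (s b c)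
           + S 0 (p a b + s a b) c - s a (S 0 b c))"
    using middle[of "\<lambda>pi si pj sj. sj (pi a b + si a b) c - si a (sj b c)"] \<open>N \<ge> 1\<close>
    by (simp add: simps del: fun_upd_apply) (simp add: algebra_simps)
qed

section \<open>The obstruction is a cocycle\<close>

lemma bilinear_map_iff:
  assumes "vector_space scale"
  shows "bilinear_map scale B \<longleftrightarrow> biadditive B \<and>
    (\<forall>k a b. B (scale k a) b = scale k (B a b) \<and> B a (scale k b) = scale k (B a b))"
  using assms unfolding bilinear_map_def Vector_Spaces.linear_iff biadditive_def by auto

lemma dend_cochain_2_bilinear:
  assumes g: "g \<in> dend_cochains scale 2" and "r \<in> {1, 2}"
  shows "bilinear_map scale (\<lambda>a b. g r [a, b])"
proof -
  have "\<forall>r\<in>{1..2}. \<forall>as. length as = 2 \<longrightarrow>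
      (\<forall>i<2. Vector_Spaces.linear scale scale (\<lambda>x. g r (as[i := x])))"
    using g unfolding dend_cochains_def by blast
  then have *: "Vector_Spaces.linear scale scale (\<lambda>x. g r ([a, b][i := x]))" if "i < 2" for a b i
    by (elim ballE[of _ _ r] allE[of _ "[a, b]"] impE allE[of _ i]) (use that \<open>r \<in> {1, 2}\<close> in auto)
  show ?thesis
    using *[of 0] *[of 1] unfolding bilinear_map_def by simp
qed

text \<open>The defect of degree \<open>N\<close> as a 3-cochain, with the value zero outside the domain of
  3-cochains.\<close>

definition dend_obstruction ::
  "(nat \<Rightarrow> 'a::ab_group_add \<Rightarrow> 'a \<Rightarrow> 'a) \<Rightarrow> (nat \<Rightarrow> 'a \<Rightarrow> 'a \<Rightarrow> 'a) \<Rightarrow> nat \<Rightarrow>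
   nat \<Rightarrow> 'a list \<Rightarrow> 'a" where
  "dend_obstruction P S N r as =
     (if r \<in> {1..3} \<and> length as = 3 then dend_defect P S N r (as ! 0) (as ! 1) (as ! 2) else 0)"

lemma length_3E:
  assumes "length as = 3" obtains a b c where "as = [a, b, c]"
  using assms by (auto simp: numeral_3_eq_3 length_Suc_conv)

lemma length_4E:
  assumes "length as = 4" obtains a b c d where "as = [a, b, c, d]"
  using assms by (auto simp: numeral_eq_Suc length_Suc_conv)

lemma dend_obstruction_cochain:
  fixes scale :: "'k::field \<Rightarrow> 'a::ab_group_add \<Rightarrow> 'a"
  assumes "vector_space scale"
    and P: "\<And>i. bilinear_map scale (P i)" and S: "\<And>i. bilinear_map scale (S i)"
  shows "dend_obstruction P S N \<in> dend_cochains scale 3"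
proof -
  interpret vector_space scale by fact
  note P' = P[unfolded bilinear_map_iff[OF assms(1)]]
    and S' = S[unfolded bilinear_map_iff[OF assms(1)]]
  have add: "biadditive (P i)" "biadditive (S i)" for i using P' S' by auto
  have hom: "P i (scale k a) b = scale k (P i a b)" "P i a (scale k b) = scale k (P i a b)"
     "S i (scale k a) b = scale k (S i a b)" "S i a (scale k b) = scale k (S i a b)" for i k a b
    using P' S' by auto
  let ?D = "dend_defect P S N"
  note simps = Vector_Spaces.linear_iff assms(1) dend_defect_def biadditive_add[OF add(1)] biadditive_add[OF add(2)]
      hom scale_sum_right sum.distrib[symmetric] case_prod_unfold
      scale_right_distrib scale_right_diff_distrib
  have "Vector_Spaces.linear scale scale (\<lambda>x. ?D r x b c)" for r b c
    by (simp add: simps) (auto intro!: sum.cong simp: simps algebra_simps)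
  moreover have "Vector_Spaces.linear scale scale (\<lambda>x. ?D r a x c)" for r a c
    by (simp add: simps) (auto intro!: sum.cong simp: simps algebra_simps)
  moreover have "Vector_Spaces.linear scale scale (\<lambda>x. ?D r a b x)" for r a b
    by (simp add: simps) (auto intro!: sum.cong simp: simps algebra_simps)
  ultimately have "Vector_Spaces.linear scale scale (\<lambda>x. dend_obstruction P S N r (as[i := x]))"
    if "r \<in> {1..3}" "length as = 3" "i < 3" for r as i
    using that
    by (elim length_3E) (auto simp: dend_obstruction_def less_Suc_eq numeral_eq_Suc)
  then show ?thesis
    unfolding dend_cochains_def by (auto simp: dend_obstruction_def)
qed

lemma sum_1_to_2: "(\<Sum>s = 1..2. F s) = F 1 + F (2::nat)"
  by (simp add: numeral_eq_Suc)

lemma sum_1_to_3: "(\<Sum>s = 1..3. F s) = F 1 + F 2 + F (3::nat)"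
  by (simp add: numeral_eq_Suc)

lemmas dend_delta_simps = dend_delta_def lin_ext_def R_def R0_def basis_symbol_def dend_pi_def
  sum_1_to_2[unfolded One_nat_def] sum_1_to_3[unfolded One_nat_def]

lemma dend_delta_2:
  fixes scale :: "'k::field \<Rightarrow> 'a::ab_group_add \<Rightarrow> 'a"
  assumes "vector_space scale"
  shows "dend_delta scale prec succ 2 g 1 [a, b, c] =
      prec a (g 1 [b, c] + g 2 [b, c]) - g 1 [prec a b, c]
      + g 1 [a, prec b c + succ b c] - prec (g 1 [a, b]) c"
    and "dend_delta scale prec succ 2 g 2 [a, b, c] =
      succ a (g 1 [b, c]) - g 1 [succ a b, c] + g 2 [a, prec b c] - prec (g 2 [a, b]) c"
    and "dend_delta scale prec succ 2 g 3 [a, b, c] =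
      succ a (g 2 [b, c]) - g 2 [prec a b + succ a b, c]
      + g 2 [a, succ b c] - succ (g 1 [a, b] + g 2 [a, b]) c"
proof -
  interpret vector_space scale by fact
  show "dend_delta scale prec succ 2 g 1 [a, b, c] =
      prec a (g 1 [b, c] + g 2 [b, c]) - g 1 [prec a b, c]
      + g 1 [a, prec b c + succ b c] - prec (g 1 [a, b]) c"
    by (simp add: dend_delta_simps flip: numeral_2_eq_2)
  show "dend_delta scale prec succ 2 g 2 [a, b, c] =
      succ a (g 1 [b, c]) - g 1 [succ a b, c] + g 2 [a, prec b c] - prec (g 2 [a, b]) c"
    by (simp add: dend_delta_simps flip: numeral_2_eq_2)
  show "dend_delta scale prec succ 2 g 3 [a, b, c] =
      succ a (g 2 [b, c]) - g 2 [prec a b + succ a b, c]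
      + g 2 [a, succ b c] - succ (g 1 [a, b] + g 2 [a, b]) c"
    by (simp add: dend_delta_simps flip: numeral_2_eq_2)
qed

lemma dend_delta_3:
  fixes scale :: "'k::field \<Rightarrow> 'a::ab_group_add \<Rightarrow> 'a"
  assumes "vector_space scale"
  shows "dend_delta scale prec succ 3 f 1 [w, x, y, z] =
      prec w (f 1 [x, y, z] + f 2 [x, y, z] + f 3 [x, y, z]) - f 1 [prec w x, y, z]
      + f 1 [w, prec x y + succ x y, z] - f 1 [w, x, prec y z + succ y z] + prec (f 1 [w, x, y]) z"
    and "dend_delta scale prec succ 3 f 2 [w, x, y, z] =
      succ w (f 1 [x, y, z]) - f 1 [succ w x, y, z]
      + f 2 [w, prec x y, z] - f 2 [w, x, prec y z + succ y z] + prec (f 2 [w, x, y]) z"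
    and "dend_delta scale prec succ 3 f 3 [w, x, y, z] =
      succ w (f 2 [x, y, z]) - f 2 [prec w x + succ w x, y, z]
      + f 2 [w, succ x y, z] - f 3 [w, x, prec y z] + prec (f 3 [w, x, y]) z"
    and "dend_delta scale prec succ 3 f 4 [w, x, y, z] =
      succ w (f 3 [x, y, z]) - f 3 [prec w x + succ w x, y, z]
      + f 3 [w, prec x y + succ x y, z] - f 3 [w, x, succ y z]
      + succ (f 1 [w, x, y] + f 2 [w, x, y] + f 3 [w, x, y]) z"
proof -
  interpret vector_space scale by fact
  show "dend_delta scale prec succ 3 f 1 [w, x, y, z] =
      prec w (f 1 [x, y, z] + f 2 [x, y, z] + f 3 [x, y, z]) - f 1 [prec w x, y, z]
      + f 1 [w, prec x y + succ x y, z] - f 1 [w, x, prec y z + succ y z] + prec (f 1 [w, x, y]) z"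
    by (simp add: dend_delta_simps flip: numeral_2_eq_2)
  show "dend_delta scale prec succ 3 f 2 [w, x, y, z] =
      succ w (f 1 [x, y, z]) - f 1 [succ w x, y, z]
      + f 2 [w, prec x y, z] - f 2 [w, x, prec y z + succ y z] + prec (f 2 [w, x, y]) z"
    by (simp add: dend_delta_simps flip: numeral_2_eq_2)
  show "dend_delta scale prec succ 3 f 3 [w, x, y, z] =
      succ w (f 2 [x, y, z]) - f 2 [prec w x + succ w x, y, z]
      + f 2 [w, succ x y, z] - f 3 [w, x, prec y z] + prec (f 3 [w, x, y]) z"
    by (simp add: dend_delta_simps flip: numeral_2_eq_2)
  show "dend_delta scale prec succ 3 f 4 [w, x, y, z] =
      succ w (f 3 [x, y, z]) - f 3 [prec w x + succ w x, y, z]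
      + f 3 [w, prec x y + succ x y, z] - f 3 [w, x, succ y z]
      + succ (f 1 [w, x, y] + f 2 [w, x, y] + f 3 [w, x, y]) z"
    by (simp add: dend_delta_simps flip: numeral_2_eq_2)
qed

lemma dend_obstruction_cocycle:
  fixes scale :: "'k::field \<Rightarrow> 'a::ab_group_add \<Rightarrow> 'a"
  assumes V: "vector_space scale"
    and P: "\<And>i. bilinear_map scale (P i)" and S: "\<And>i. bilinear_map scale (S i)"
    and lower: "\<And>m r a b c. m < N \<Longrightarrow> r \<in> {1, 2, 3} \<Longrightarrow> dend_defect P S m r a b c = 0"
  shows "dend_obstruction P S N \<in> dend_cocycles scale (P 0) (S 0) 3"
proof -
  have add: "biadditive (P i)" "biadditive (S i)" for i
    using P S by (auto simp: bilinear_map_iff[OF V])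
  have "dend_delta scale (P 0) (S 0) 3 (dend_obstruction P S N) r as = 0" for r as
  proof (cases "r \<in> {1..4} \<and> length as = 4")
    case True
    then obtain w x y z where as: "as = [w, x, y, z]" by (auto elim: length_4E)
    note cocycle = dend_defect_lowest_cocycle[of P S N, OF add lower, of w x y z]
    from True consider "r = 1" | "r = 2" | "r = 3" | "r = 4" by fastforce
    then show ?thesis
      using cocycle by cases (simp_all add: as dend_delta_3[OF V, unfolded One_nat_def] dend_obstruction_def)
  next
    case False
    then show ?thesis by (auto simp: dend_delta_def)
  qed
  then show ?thesis
    using dend_obstruction_cochain[of scale P S N] assms by (auto simp: dend_cocycles_def fun_eq_iff)
qed

text \<open>Vanishing cohomology is stated through the quotient having the coboundaries as its only class;
  a class contains its representative because zero is a coboundary.\<close>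

lemma cocycle_is_coboundary:
  assumes vanish: "dend_cohomology_vanishes scale prec succ n"
    and f: "f \<in> dend_cocycles scale prec succ n"
    and zero: "(\<lambda>r as. 0) \<in> dend_coboundaries scale prec succ n"
  shows "f \<in> dend_coboundaries scale prec succ n"
proof -
  let ?r = "{(f, g). f \<in> dend_cocycles scale prec succ n \<and> g \<in> dend_cocycles scale prec succ n \<and>
                (\<lambda>r as. f r as - g r as) \<in> dend_coboundaries scale prec succ n}"
  have "?r `` {f} \<in> dend_cohomology scale prec succ n"
    unfolding dend_cohomology_def using f by (rule quotientI)
  then have "?r `` {f} = dend_coboundaries scale prec succ n"
    using vanish by (simp add: dend_cohomology_vanishes_def)
  moreover have "f \<in> ?r `` {f}" using f zero by simp
  ultimately show ?thesis by simp
qed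

lemma zero_coboundary_3:
  assumes "dendriform_algebra scale prec succ"
  shows "(\<lambda>r as. 0) \<in> dend_coboundaries scale prec succ 3"
proof -
  interpret dendriform_algebra scale prec succ by fact
  have V: "vector_space scale" by unfold_locales
  have add: "biadditive prec" "biadditive succ"
    using bilinear_prec bilinear_succ by (auto simp: bilinear_map_iff[OF V])
  have "(\<lambda>r as. 0) \<in> dend_cochains scale 2"
    by (simp add: dend_cochains_def Vector_Spaces.linear_iff V)
  moreover have "dend_delta scale prec succ 2 (\<lambda>r as. 0) = (\<lambda>r as. 0)"
    by (simp add: dend_delta_def lin_ext_def dend_pi_def fun_eq_iff
        biadditive_zero[OF add(1)] biadditive_zero[OF add(2)])
  ultimately show ?thesis
    unfolding dend_coboundaries_def by (metis (no_types, lifting) diff_Suc_1 eval_nat_numeral(3) image_eqI)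
qed

section \<open>Extension of deformations\<close>

theorem theorem3p9:
  fixes scale :: "'k::field_char_0 \<Rightarrow> 'a::ab_group_add \<Rightarrow> 'a"
    and prec succ :: "'a \<Rightarrow> 'a \<Rightarrow> 'a"
  assumes "dendriform_algebra scale prec succ"
    and "dend_cohomology_vanishes scale prec succ 3"
  shows "\<forall>n\<ge>1. \<forall>P S. dend_deformation scale prec succ n P S \<longrightarrow>
           (\<exists>P' S'. bilinear_map scale P' \<and> bilinear_map scale S' \<and>
              dend_deformation scale prec succ (n + 1) (P(n + 1 := P')) (S(n + 1 := S')))"
proof (intro allI impI)
  fix n P S
  assume deform: "dend_deformation scale prec succ n P S"
  interpret dendriform_algebra scale prec succ by fact
  have V: "vector_space scale" by unfold_locales
  define N where "N = n + 1"
  \<comment> \<open>The coefficients of degree above \<open>n\<close> are arbitrary functions, possibly not bilinear;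
    they are replaced by zero.\<close>
  define P0 where "P0 = (\<lambda>i. if i \<le> n then P i else (\<lambda>_ _. 0))"
  define S0 where "S0 = (\<lambda>i. if i \<le> n then S i else (\<lambda>_ _. 0))"
  have bil: "bilinear_map scale (P0 i)" "bilinear_map scale (S0 i)" for i
    using deform by (auto simp: P0_def S0_def dend_deformation_iff bilinear_map_def Vector_Spaces.linear_iff V)
  have at_0: "P0 0 = prec" "S0 0 = succ"
    using deform by (auto simp: P0_def S0_def dend_deformation_iff)
  have agree: "dend_defect P S m r a b c = dend_defect P0 S0 m r a b c" if "m < N" for m r a b c
    using that by (intro dend_defect_cong) (auto simp: P0_def S0_def N_def)
  have lower: "dend_defect P0 S0 m r a b c = 0" if "m < N" "r \<in> {1, 2, 3}" for m r a b c
    using deform that by (auto simp: agree[symmetric] dend_deformation_iff N_def less_Suc_eq_le)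
  have "dend_obstruction P0 S0 N \<in> dend_cocycles scale prec succ 3"
    using dend_obstruction_cocycle[of scale P0 S0 N, OF V bil lower] by (simp add: at_0)
  then have "dend_obstruction P0 S0 N \<in> dend_coboundaries scale prec succ 3"
    by (rule cocycle_is_coboundary[OF assms(2) _ zero_coboundary_3[OF assms(1)]])
  then obtain g where g: "g \<in> dend_cochains scale 2"
    and delta_g: "dend_obstruction P0 S0 N = dend_delta scale prec succ 2 g"
    unfolding dend_coboundaries_def by auto
  define P' where "P' = (\<lambda>a b. g 1 [a, b])"
  define S' where "S' = (\<lambda>a b. g 2 [a, b])"
  have g_eq: "g 1 [a, b] = P' a b" "g 2 [a, b] = S' a b" for a b
    by (simp_all add: P'_def S'_def)
  have bil': "bilinear_map scale P'" "bilinear_map scale S'"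
    unfolding P'_def S'_def by (rule dend_cochain_2_bilinear[OF g], simp)+
  have D0: "dend_defect P0 S0 N r a b c = dend_delta scale prec succ 2 g r [a, b, c]"
    if "r \<in> {1, 2, 3}" for r a b c
    using that fun_cong[OF fun_cong[OF delta_g, of r], of "[a, b, c]"]
    by (auto simp: dend_obstruction_def)
  have upd: "dend_defect (P(N := P')) (S(N := S')) m r a b c =
      dend_defect (P0(N := P')) (S0(N := S')) m r a b c" if "m \<le> N" for m r a b c
    using that by (intro dend_defect_cong) (auto simp: P0_def S0_def N_def)
  have "dend_defect (P(N := P')) (S(N := S')) m r a b c = 0"
    if "m \<le> N" "r \<in> {1, 2, 3}" for m r a b c
  proof (cases "m = N")
    case True
    have add: "biadditive (P0 0)" "biadditive (S0 0)"
      using bil by (auto simp: bilinear_map_iff[OF V])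
    have "N \<ge> 1" "P0 N = (\<lambda>_ _. 0)" "S0 N = (\<lambda>_ _. 0)"
      by (auto simp: N_def P0_def S0_def)
    note update = dend_defect_update[OF this(1) add this(2, 3), of P' S' a b c]
    from that(2) consider "r = 1" | "r = 2" | "r = 3" by auto
    then show ?thesis
      unfolding True upd[OF order.refl]
      by cases (simp_all add: update[unfolded One_nat_def] D0[of 1, simplified] D0
          dend_delta_2[OF V, unfolded One_nat_def] at_0 g_eq[unfolded One_nat_def])
  next
    case False
    then have "dend_defect (P0(N := P')) (S0(N := S')) m r a b c = dend_defect P0 S0 m r a b c"
      using that by (intro dend_defect_cong) auto
    then show ?thesis using that False by (simp add: upd lower del: insert_iff)
  qed
  then have "dend_deformation scale prec succ N (P(N := P')) (S(N := S'))"
    using deform bil' by (auto simp: dend_deformation_iff N_def le_Suc_eq simp del: insert_iff)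
  then show "\<exists>P' S'. bilinear_map scale P' \<and> bilinear_map scale S' \<and>
      dend_deformation scale prec succ (n + 1) (P(n + 1 := P')) (S(n + 1 := S'))"
    using bil' unfolding N_def by blast
qed

end
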